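(* Let $\mathcal{W}$ be a periodic labeled wedge of period $p$ and preperiod $q$ with associated graph $\Gamma$, and for $k\ge1$ let $\Gamma_k=\Gamma/\equiv_{kp,q}$. Then the sequence of spectral determinants $(P_{\Gamma_k}(t))_{k\ge1}$ converges uniformly to $P_\Gamma(t)$ on compact subsets of the open unit disk $\mathbb{D}$. As a consequence, roots of $P_\Gamma$ in $\mathbb{D}$ are approximated arbitrarily well by roots of $P_{\Gamma_k}$.
   Context: $\Sigma=\{(i,j)\in\mathbb{N}^2:1\le i\le j\}$; a labeled wedge is $\Phi:\Sigma\to\{N,S,E\}$. Its graph $\Gamma$: vertices $\Sigma$; no edges out of $E$-vertices; $(i,j)\to(i+1,j+1)$ out of $N$-vertices; $(i,j)\to(1,i+1)$ and $(i,j)\to(1,j+1)$ out of $S$-vertices. For $p\ge1,q\ge0$: $i\equiv_{p,q}j$ iff $i=j$ or ($\min\{i,j\}\ge q+1$ and $i\equiv j\bmod p$); on $\Sigma$, $(i,j)\equiv_{p,q}(k,l)$ iff ($i\equiv_{p,q}k$, $j\equiv_{p,q}l$) or ($i\equiv_{p,q}l$, $j\equiv_{p,q}k$). $\mathcal{W}$ is periodic of period $p$ and preperiod $q$ if equivalent vertices have equal labels and $(i,j)$ is labeled $E$ iff $i\equiv_{p,q}j$. $\Gamma_k$ is the quotient graph by $\equiv_{kp,q}$: vertices are classes and the number of edges $[v]\to[w]$ is the number of edges from $v$ to members of $[w]$. A simple cycle is a non-self-intersecting closed path up to cyclic permutation; a multicycle is a finite (possibly empty) union of simple cycles with disjoint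 vertex sets, of length $\ell(\gamma)$ (total edges) and with $C(\gamma)$ components. The spectral determinant is $P(t)=\sum_\gamma(-1)^{C(\gamma)}t^{\ell(\gamma)}$; for $\Gamma$ this is a power series (finitely many multicycles of each length) converging on $\mathbb{D}$. *)

theory Defs
  imports "HOL-Analysis.Analysis"
begin

datatype label = N | S | E

definition wedge_Sigma :: "(nat \<times> nat) set" where
  "wedge_Sigma = {(i, j). 1 \<le> i \<and> i \<le> j}"

text \<open>A labeled wedge is a map Phi : Sigma -> {N,S,E}; we use a total function
  on nat x nat whose values off Sigma are irrelevant.\<close>
type_synonym wedge = "nat \<times> nat \<Rightarrow> label"

fun out_edges :: "wedge \<Rightarrow> nat \<times> nat \<Rightarrow> (nat \<times> nat) list" where
  "out_edges Phi (i, j) =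
     (case Phi (i, j) of
        E \<Rightarrow> []
      | N \<Rightarrow> [(i + 1, j + 1)]
      | S \<Rightarrow> [(1, i + 1), (1, j + 1)])"

definition gamma_w :: "wedge \<Rightarrow> nat \<times> nat \<Rightarrow> nat \<times> nat \<Rightarrow> nat" where
  "gamma_w Phi v u = length (filter (\<lambda>x. x = u) (out_edges Phi v))"

definition eq_pq :: "nat \<Rightarrow> nat \<Rightarrow> nat \<Rightarrow> nat \<Rightarrow> bool" where
  "eq_pq p q i j \<longleftrightarrow> i = j \<or> (min i j \<ge> q + 1 \<and> i mod p = j mod p)"

definition eqv_pq :: "nat \<Rightarrow> nat \<Rightarrow> nat \<times> nat \<Rightarrow> nat \<times> nat \<Rightarrow> bool" where
  "eqv_pq p q v u \<longleftrightarrow>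
     (eq_pq p q (fst v) (fst u) \<and> eq_pq p q (snd v) (snd u)) \<or>
     (eq_pq p q (fst v) (snd u) \<and> eq_pq p q (snd v) (fst u))"

definition eqv_rel :: "nat \<Rightarrow> nat \<Rightarrow> ((nat \<times> nat) \<times> (nat \<times> nat)) set" where
  "eqv_rel p q = {(v, u). v \<in> wedge_Sigma \<and> u \<in> wedge_Sigma \<and> eqv_pq p q v u}"

definition periodic_wedge :: "wedge \<Rightarrow> nat \<Rightarrow> nat \<Rightarrow> bool" where
  "periodic_wedge Phi p q \<longleftrightarrow> p \<ge> 1 \<and>
     (\<forall>v\<in>wedge_Sigma. \<forall>u\<in>wedge_Sigma. eqv_pq p q v u \<longrightarrow> Phi v = Phi u) \<and>
     (\<forall>i j. (i, j) \<in> wedge_Sigma \<longrightarrow> (Phi (i, j) = E \<longleftrightarrow> eq_pq p q i j))"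

definition quot_vertices :: "nat \<Rightarrow> nat \<Rightarrow> (nat \<times> nat) set set" where
  "quot_vertices p q = wedge_Sigma // eqv_rel p q"

text \<open>Number of edges [v] -> D: number of edges from a member v of the class C
  to members of D (independent of the representative for periodic wedges).\<close>
definition quot_w :: "wedge \<Rightarrow> (nat \<times> nat) set \<Rightarrow> (nat \<times> nat) set \<Rightarrow> nat" where
  "quot_w Phi C D = length (filter (\<lambda>u. u \<in> D) (out_edges Phi (SOME v. v \<in> C)))"

text \<open>A directed multigraph is given by a vertex set V and edge multiplicities
  w x y (number of edges x -> y). A simple cycle (non-self-intersecting closed path,
  up to cyclic permutation) is represented by its set of arcs; its edges may be
  chosen among parallel edges, which is accounted for by the weight below.\<close>
definition simple_cycle :: "'v set \<Rightarrow> ('v \<Rightarrow> 'v \<Rightarrow> nat) \<Rightarrow> ('v \<times> 'v) set \<Rightarrow> bool" where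
  "simple_cycle V w A \<longleftrightarrow>
     (\<exists>xs. xs \<noteq> [] \<and> distinct xs \<and> set xs \<subseteq> V \<and>
        (\<forall>i<length xs. 0 < w (xs ! i) (xs ! (Suc i mod length xs))) \<and>
        A = {(xs ! i, xs ! (Suc i mod length xs)) | i. i < length xs})"

definition multicycle :: "'v set \<Rightarrow> ('v \<Rightarrow> 'v \<Rightarrow> nat) \<Rightarrow> ('v \<times> 'v) set set \<Rightarrow> bool" where
  "multicycle V w M \<longleftrightarrow> finite M \<and> (\<forall>A\<in>M. simple_cycle V w A) \<and>
     (\<forall>A\<in>M. \<forall>B\<in>M. A \<noteq> B \<longrightarrow> fst ` A \<inter> fst ` B = {})"

definition mc_length :: "('v \<times> 'v) set set \<Rightarrow> nat" where
  "mc_length M = (\<Sum>A\<in>M. card A)"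

text \<open>Number of ways to realise the multicycle using (parallel) edges.\<close>
definition mc_weight :: "('v \<Rightarrow> 'v \<Rightarrow> nat) \<Rightarrow> ('v \<times> 'v) set set \<Rightarrow> nat" where
  "mc_weight w M = (\<Prod>A\<in>M. \<Prod>(x, y)\<in>A. w x y)"

definition spec_coeff :: "'v set \<Rightarrow> ('v \<Rightarrow> 'v \<Rightarrow> nat) \<Rightarrow> nat \<Rightarrow> int" where
  "spec_coeff V w n =
     (\<Sum>M\<in>{M. multicycle V w M \<and> mc_length M = n}. (-1) ^ card M * int (mc_weight w M))"

definition spec_det :: "'v set \<Rightarrow> ('v \<Rightarrow> 'v \<Rightarrow> nat) \<Rightarrow> complex \<Rightarrow> complex" where
  "spec_det V w t = (\<Sum>n. of_int (spec_coeff V w n) * t ^ n)"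

abbreviation P_Gamma :: "wedge \<Rightarrow> complex \<Rightarrow> complex" where
  "P_Gamma Phi \<equiv> spec_det wedge_Sigma (gamma_w Phi)"

abbreviation P_Gamma_k :: "wedge \<Rightarrow> nat \<Rightarrow> nat \<Rightarrow> nat \<Rightarrow> complex \<Rightarrow> complex" where
  "P_Gamma_k Phi p q k \<equiv> spec_det (quot_vertices (k * p) q) (quot_w Phi)"

end

theory Submission
  imports Defs "HOL-Real_Asymp.Real_Asymp" "HOL-Complex_Analysis.Great_Picard"
begin

text \<open>Represent each class of \<open>\<equiv>\<^bsub>kp,q\<^esub>\<close> by a pair \<open>i \<le> j \<le> T = q + k p\<close> and call \<open>j\<close> the height.
  All edges raise the height by one, except for the backward edges \<open>(i, j) \<rightarrow> (1, i + 1)\<close> and the edges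
  out of the top level \<open>j = T\<close>. The exceptional edges of a multicycle determine it. Those of either
  kind have sources with distinct first coordinates, and a vertex \<open>(i, j)\<close> of a multicycle is preceded
  by \<open>i - q - 1\<close> upward edges; so a multicycle of length \<open>n\<close> has only \<open>O(\<surd>n)\<close> exceptional edges and height
  at most \<open>2 n + q\<close>. Consequently the coefficients of all the determinants are bounded, uniformly in \<open>k\<close>,
  by a subexponential sequence, and the \<open>n\<close>-th coefficient for \<open>\<Gamma>\<^sub>k\<close> equals that for \<open>\<Gamma>\<close> as soon as
  \<open>k p > 2 n\<close>. Dominated convergence gives the uniform limit, and Hurwitz's theorem the roots.\<close>

subsection \<open>Multicycles as sets of arcs\<close>

text \<open>In terms of arcs, a simple cycle is a permutation of its vertices with a single orbit;
  the last fact expresses the single orbit.\<close>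

lemma simple_cycle_arcs:
  assumes "simple_cycle V w A"
  shows "finite A" "A \<noteq> {}" "single_valued A" "single_valued (A\<inverse>)" "Domain A = Range A"
    "Domain A \<subseteq> V" "\<And>x y. (x, y) \<in> A \<Longrightarrow> 0 < w x y"
    "\<And>x y. x \<in> Domain A \<Longrightarrow> y \<in> Domain A \<Longrightarrow> (x, y) \<in> A\<^sup>*"
proof -
  obtain xs where xs: "xs \<noteq> []" "distinct xs" "set xs \<subseteq> V"
    "\<forall>i<length xs. 0 < w (xs ! i) (xs ! (Suc i mod length xs))"
    and A: "A = {(xs ! i, xs ! (Suc i mod length xs)) | i. i < length xs}"
    using assms unfolding simple_cycle_def by blast
  define L where "L = length xs"
  have L: "L > 0" using xs by (simp add: L_def)
  have A': "A = (\<lambda>i. (xs ! i, xs ! (Suc i mod L))) ` {..<L}"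
    using A by (auto simp: L_def)
  show "finite A" "A \<noteq> {}" using L by (auto simp: A')
  have eq: "xs ! i = xs ! j \<longleftrightarrow> i = j" if "i < L" "j < L" for i j
    using that xs(2) by (simp add: L_def nth_eq_iff_index_eq)
  show "single_valued A"
    by (auto simp: A' single_valued_def eq)
  have suc: "i = j" if "Suc i mod L = Suc j mod L" "i < L" "j < L" for i j
    using that by (auto simp: mod_Suc split: if_splits)
  show "single_valued (A\<inverse>)"
    using L by (auto simp: A' single_valued_def eq intro: suc)
  have dom: "Domain A = set xs"
    by (force simp: A' L_def in_set_conv_nth)
  have "Range A = set xs"
  proof (intro equalityI subsetI)
    fix x assume "x \<in> set xs"
    then obtain i where i: "i < L" "x = xs ! i" by (auto simp: L_def in_set_conv_nth)
    define j where "j = (if i = 0 then L - 1 else i - 1)"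
    have "j < L" "Suc j mod L = i" using i L by (auto simp: j_def)
    then show "x \<in> Range A" using i by (force simp: A')
  qed (use L in \<open>auto simp: A' L_def\<close>)
  then show "Domain A = Range A" using dom by simp
  show "Domain A \<subseteq> V" using dom xs by simp
  show "0 < w x y" if "(x, y) \<in> A" for x y
    using that xs(4) by (auto simp: A)
  have reach: "(xs ! i, xs ! ((i + d) mod L)) \<in> A\<^sup>*" if "i < L" for i d
  proof (induction d)
    case 0 then show ?case using that by simp
  next
    case (Suc d)
    have "(xs ! ((i + d) mod L), xs ! (Suc ((i + d) mod L) mod L)) \<in> A"
      using L by (auto simp: A')
    then show ?case using Suc by (simp add: mod_Suc_eq rtrancl_into_rtrancl)
  qed
  fix x y assume "x \<in> Domain A" "y \<in> Domain A"
  then obtain i j where ij: "i < L" "x = xs ! i" "j < L" "y = xs ! j"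
    by (auto simp: dom L_def in_set_conv_nth)
  \<comment> \<open>\<open>L\<close> is added first because \<open>j - i\<close> would be truncated
    when \<open>j < i\<close>.\<close>
  then have "(i + (j + L - i)) mod L = j" by simp
  with reach[OF ij(1), of "j + L - i"] ij show "(x, y) \<in> A\<^sup>*" by simp
qed

text \<open>Vertex-disjoint cycles combine into one partial permutation \<open>\<Union>M\<close>.
  Distinct cycles share no arc, so length and weight can be read off from the union.\<close>

lemma multicycle_arcs:
  assumes "multicycle V w M"
  shows "finite (\<Union>M)" "single_valued (\<Union>M)" "single_valued ((\<Union>M)\<inverse>)"
    "Domain (\<Union>M) = Range (\<Union>M)" "Domain (\<Union>M) \<subseteq> V"
    "\<And>x y. (x, y) \<in> \<Union>M \<Longrightarrow> 0 < w x y"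
    "mc_length M = card (\<Union>M)" "mc_weight w M = (\<Prod>(x, y)\<in>\<Union>M. w x y)"
proof -
  note c = simple_cycle_arcs
  have fin: "finite M" and cyc: "\<And>A. A \<in> M \<Longrightarrow> simple_cycle V w A"
    and eq: "\<And>A B x. A \<in> M \<Longrightarrow> B \<in> M \<Longrightarrow> x \<in> Domain A \<Longrightarrow> x \<in> Domain B \<Longrightarrow> A = B"
    using assms unfolding multicycle_def fst_eq_Domain by blast+
  show "finite (\<Union>M)" using fin c(1)[OF cyc] by blast
  show "single_valued (\<Union>M)"
    unfolding single_valued_def
    by (metis Domain.DomainI UnionE c(3)[OF cyc] eq single_valuedD)
  show "single_valued ((\<Union>M)\<inverse>)"
    unfolding single_valued_def
  proof (intro allI impI)
    fix z x y assume "(z, x) \<in> (\<Union>M)\<inverse>" "(z, y) \<in> (\<Union>M)\<inverse>"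
    then obtain A B where AB: "A \<in> M" "(x, z) \<in> A" "B \<in> M" "(y, z) \<in> B" by blast
    then have "z \<in> Domain A" "z \<in> Domain B" using c(5)[OF cyc] by blast+
    then have "A = B" using eq AB by blast
    then show "x = y" using AB c(4)[OF cyc[OF AB(1)]] by (auto simp: single_valued_def)
  qed
  show "Domain (\<Union>M) = Range (\<Union>M)" "Domain (\<Union>M) \<subseteq> V"
    by (simp add: Domain_Union Range_Union c(5)[OF cyc])
       (use c(6)[OF cyc] in \<open>simp add: Domain_Union UN_least\<close>)
  show "\<And>x y. (x, y) \<in> \<Union>M \<Longrightarrow> 0 < w x y" using c(7)[OF cyc] by blast
  have disj: "\<forall>A\<in>M. \<forall>B\<in>M. A \<noteq> B \<longrightarrow> A \<inter> B = {}"
  proof (intro ballI impI)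
    fix A B assume AB: "A \<in> M" "B \<in> M" "A \<noteq> B"
    have "p \<notin> B" if "p \<in> A" for p
      using eq[OF AB(1,2), of "fst p"] AB(3) that by (metis Domain.DomainI prod.collapse)
    then show "A \<inter> B = {}" by blast
  qed
  show "mc_length M = card (\<Union>M)"
    unfolding mc_length_def
    by (rule card_Union_disjoint[symmetric])
       (use c(1)[OF cyc] disj in \<open>auto simp: pairwise_def disjnt_def\<close>)
  show "mc_weight w M = (\<Prod>(x, y)\<in>\<Union>M. w x y)"
    unfolding mc_weight_def
    using prod.Union_disjoint[of M "\<lambda>(x, y). w x y"] c(1)[OF cyc] disj by simp
qed

lemma multicycle_arcs_subset:
  assumes "multicycle V w M"
  shows "\<Union>M \<subseteq> V \<times> V"
proof (rule subrelI)
  fix x y assume "(x, y) \<in> \<Union>M"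
  then have "x \<in> Domain (\<Union>M)" "y \<in> Range (\<Union>M)" by blast+
  then show "(x, y) \<in> V \<times> V" using multicycle_arcs(4,5)[OF assms] by auto
qed

text \<open>As \<open>\<Union>M\<close> is single-valued, a path starting on a cycle cannot leave
  it. The cycles are thus the orbits of the union.\<close>

lemma multicycle_component:
  assumes "multicycle V w M" "A \<in> M" "x \<in> Domain A"
  shows "A = {(y, z) \<in> \<Union>M. (x, y) \<in> (\<Union>M)\<^sup>*}"
proof -
  have cyc: "simple_cycle V w A" using assms by (auto simp: multicycle_def)
  note c = simple_cycle_arcs[OF cyc]
  have sub: "(y, z) \<in> A" if "y \<in> Domain A" "(y, z) \<in> \<Union>M" for y z
    using that assms multicycle_arcs(2)[OF assms(1)] by (metis Domain.cases UnionI single_valuedD)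
  have "y \<in> Domain A" if "(x, y) \<in> (\<Union>M)\<^sup>*" for y
    using that
  proof (induction rule: rtrancl_induct)
    case (step y z)
    then show ?case using sub c(5) by blast
  qed (use assms in auto)
  moreover have "(x, y) \<in> (\<Union>M)\<^sup>*" if "(y, z) \<in> A" for y z
    using c(8)[OF assms(3), of y] that rtrancl_mono[of A "\<Union>M"] assms(2) by blast
  ultimately show ?thesis using sub assms(2) by blast
qed

text \<open>The orbits of the union recover the cycles, so multicycles can be counted by their arc
  sets.\<close>

lemma multicycle_Union_inject:
  assumes "multicycle V w M" "multicycle V w M'" "\<Union>M = \<Union>M'"
  shows "M = M'"
proof -
  have "M1 \<subseteq> M2" if m: "multicycle V w M1" "multicycle V w M2" "\<Union>M1 = \<Union>M2" for M1 M2
  proof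
    fix A assume A: "A \<in> M1"
    then have "A \<noteq> {}" using m(1) simple_cycle_arcs(2) by (auto simp: multicycle_def)
    then obtain x y where xy: "(x, y) \<in> A" by auto
    then obtain B where B: "B \<in> M2" "(x, y) \<in> B" using A m(3) by blast
    have "A = B"
      using multicycle_component[OF m(1) A, of x] multicycle_component[OF m(2) B(1), of x] xy B m(3)
      by auto
    then show "A \<in> M2" using B by simp
  qed
  then show ?thesis using assms by blast
qed

text \<open>The notions involved see only the vertices on the cycles. This serves to compare two
  graphs that agree up to the height of the multicycle.\<close>

lemma multicycle_transfer:
  assumes "multicycle V w M" "Domain (\<Union>M) \<subseteq> U" "U \<subseteq> V'"
    and "\<And>x y. x \<in> U \<Longrightarrow> y \<in> U \<Longrightarrow> w x y = w' x y"
  shows "multicycle V' w' M" "mc_weight w M = mc_weight w' M"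
proof -
  have "simple_cycle V' w' A" if "A \<in> M" for A
  proof -
    have "simple_cycle V w A" using assms(1) that by (auto simp: multicycle_def)
    then obtain xs where xs: "xs \<noteq> []" "distinct xs" "set xs \<subseteq> V"
      "\<forall>i<length xs. 0 < w (xs ! i) (xs ! (Suc i mod length xs))"
      and A: "A = {(xs ! i, xs ! (Suc i mod length xs)) | i. i < length xs}"
      unfolding simple_cycle_def by blast
    have U: "xs ! i \<in> U" if "i < length xs" for i
      using A that assms(2) \<open>A \<in> M\<close> by blast
    then have "set xs \<subseteq> V'" using assms(3) by (metis in_set_conv_nth subset_iff)
    moreover have "0 < w' (xs ! i) (xs ! (Suc i mod length xs))" if "i < length xs" for i
      using that xs(1,4) assms(4)[OF U[OF that] U[of "Suc i mod length xs"]]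
      by (metis length_greater_0_conv mod_less_divisor)
    ultimately show ?thesis using xs A unfolding simple_cycle_def by blast
  qed
  then show "multicycle V' w' M" using assms(1) by (simp add: multicycle_def)
  have "w x y = w' x y" if "(x, y) \<in> \<Union>M" for x y
  proof -
    have "x \<in> Domain (\<Union>M)" using that by (rule DomainI)
    moreover have "y \<in> Domain (\<Union>M)"
      unfolding multicycle_arcs(4)[OF assms(1)] using that by (rule RangeI)
    ultimately show ?thesis by (intro assms(4)) (rule subsetD[OF assms(2)], assumption)+
  qed
  then show "mc_weight w M = mc_weight w' M"
    unfolding multicycle_arcs(8)[OF assms(1)] multicycle_arcs(8)[OF \<open>multicycle V' w' M\<close>]
    by (intro prod.cong) auto
qed

section \<open>Transport of multicycles along graph isomorphisms\<close>

lemma simple_cycle_image: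
  assumes "simple_cycle V w A" "inj_on f V" "f ` V \<subseteq> V'"
    and w: "\<forall>x\<in>V. \<forall>y\<in>V. w' (f x) (f y) = w x y"
  shows "simple_cycle V' w' (map_prod f f ` A)"
proof -
  obtain xs where xs: "xs \<noteq> []" "distinct xs" "set xs \<subseteq> V"
    "\<forall>i<length xs. 0 < w (xs ! i) (xs ! (Suc i mod length xs))"
    and A: "A = {(xs ! i, xs ! (Suc i mod length xs)) | i. i < length xs}"
    using assms(1) unfolding simple_cycle_def by blast
  have V: "xs ! i \<in> V" if "i < length xs" for i using xs(3) that by auto
  have lt: "Suc i mod length xs < length xs" for i using xs(1) by simp
  have "distinct (map f xs)" using xs(2,3) assms(2) by (simp add: distinct_map inj_on_subset)
  moreover have "set (map f xs) \<subseteq> V'" using xs(3) assms(3) by auto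
  moreover have "\<forall>i<length (map f xs).
      0 < w' (map f xs ! i) (map f xs ! (Suc i mod length (map f xs)))"
    using xs(4) w V lt by simp
  moreover have "map_prod f f ` A =
      {(map f xs ! i, map f xs ! (Suc i mod length (map f xs))) | i. i < length (map f xs)}"
    using lt by (auto simp: A image_iff) (metis (no_types, lifting) map_prod_simp nth_map)+
  ultimately show ?thesis using xs(1) unfolding simple_cycle_def by blast
qed

lemma multicycle_image:
  assumes M: "multicycle V w M" and f: "inj_on f V" "f ` V \<subseteq> V'"
    and w: "\<forall>x\<in>V. \<forall>y\<in>V. w' (f x) (f y) = w x y"
  shows "multicycle V' w' ((`) (map_prod f f) ` M)" (is "multicycle V' w' ?M")
    and "card ((`) (map_prod f f) ` M) = card M"
    and "mc_length ((`) (map_prod f f) ` M) = mc_length M"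
    and "mc_weight w' ((`) (map_prod f f) ` M) = mc_weight w M"
proof -
  let ?F = "map_prod f f"
  note m = multicycle_arcs[OF M]
  have U: "\<Union>M \<subseteq> V \<times> V" by (rule multicycle_arcs_subset[OF M])
  have inj: "inj_on ?F (V \<times> V)" using map_prod_inj_on[OF f(1) f(1)] .
  have injU: "inj_on ?F (\<Union>M)" using inj U by (rule inj_on_subset)
  have injP: "inj_on ((`) ?F) M"
    using inj_on_image[OF injU] .
  have dom: "Domain (?F ` A) = f ` Domain A" for A
    by (force simp: map_prod_def)
  have domV: "Domain A \<subseteq> V" if "A \<in> M" for A using m(5) that by blast
  have disj: "Domain A \<inter> Domain B = {}" if "A \<in> M" "B \<in> M" "A \<noteq> B" for A B
    using M that by (auto simp: multicycle_def fst_eq_Domain)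
  show *: "multicycle V' w' ?M"
    unfolding multicycle_def fst_eq_Domain
  proof (intro conjI ballI impI)
    show "finite ?M" using M by (simp add: multicycle_def)
  next
    fix A assume "A \<in> ?M"
    then show "simple_cycle V' w' A"
      using M simple_cycle_image[where w = w and w' = w', OF _ f w] by (auto simp: multicycle_def)
  next
    fix A' B' assume "A' \<in> ?M" "B' \<in> ?M" "A' \<noteq> B'"
    then obtain A B where AB: "A \<in> M" "B \<in> M" "A' = ?F ` A" "B' = ?F ` B" "A \<noteq> B" by blast
    then show "Domain A' \<inter> Domain B' = {}"
      using disj[of A B] domV[of A] domV[of B] f(1)
      by (simp add: dom flip: inj_on_image_Int)
  qed
  show "card ?M = card M" using injP by (rule card_image)
  have Un: "\<Union>?M = ?F ` \<Union>M" by blast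
  show "mc_length ?M = mc_length M"
    unfolding multicycle_arcs(7)[OF *] m(7) Un using injU by (rule card_image)
  show "mc_weight w' ?M = mc_weight w M"
    unfolding multicycle_arcs(8)[OF *] m(8) Un prod.reindex[OF injU]
    using U w by (intro prod.cong) auto
qed

lemma map_prod_multicycle_inverse:
  assumes "multicycle V w M" "\<And>x. x \<in> V \<Longrightarrow> g (f x) = x"
  shows "(`) (map_prod g g) ` (`) (map_prod f f) ` M = M"
proof -
  have *: "map_prod g g ` map_prod f f ` A = A" if "A \<in> M" for A
  proof -
    have "A \<subseteq> V \<times> V" using multicycle_arcs_subset[OF assms(1)] that by blast
    then have "map_prod g g (map_prod f f a) = a" if "a \<in> A" for a
      using that assms(2) by (cases a) auto
    then show ?thesis by (simp add: image_image)
  qed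
  have "(`) (map_prod g g) ` (`) (map_prod f f) ` M = (\<lambda>A. map_prod g g ` map_prod f f ` A) ` M"
    by (rule image_image)
  also have "\<dots> = (\<lambda>A. A) ` M" using * by (intro image_cong refl)
  finally show ?thesis by simp
qed

text \<open>Transport along \<open>f\<close> and \<open>g\<close> is a bijection of multicycles that
  keeps sign, length and weight. It will replace equivalence classes by representatives.\<close>

lemma spec_coeff_isomorphic:
  assumes f: "\<And>x. x \<in> V \<Longrightarrow> f x \<in> V'" "\<And>x. x \<in> V \<Longrightarrow> g (f x) = x"
    and g: "\<And>y. y \<in> V' \<Longrightarrow> g y \<in> V" "\<And>y. y \<in> V' \<Longrightarrow> f (g y) = y"
    and w: "\<And>x y. x \<in> V \<Longrightarrow> y \<in> V \<Longrightarrow> w' (f x) (f y) = w x y"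
  shows "spec_coeff V' w' n = spec_coeff V w n"
proof -
  have 1: "inj_on f V" "f ` V \<subseteq> V'" "inj_on g V'" "g ` V' \<subseteq> V"
    using f g inj_on_inverseI[of V g f] inj_on_inverseI[of V' f g] by auto
  have w0: "\<forall>x\<in>V. \<forall>y\<in>V. w' (f x) (f y) = w x y" using w by blast
  have w': "\<forall>x\<in>V'. \<forall>y\<in>V'. w (g x) (g y) = w' x y"
    using w g by metis
  note F = multicycle_image[where w = w and w' = w', OF _ 1(1,2) w0]
    and G = multicycle_image[where w = w' and w' = w, OF _ 1(3,4) w']
  show ?thesis
    unfolding spec_coeff_def
  proof (rule sum.reindex_bij_witness[where i = "(`) ((`) (map_prod f f))"
        and j = "(`) ((`) (map_prod g g))"])
    fix M assume "M \<in> {M. multicycle V' w' M \<and> mc_length M = n}"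
    then have M: "multicycle V' w' M" "mc_length M = n" by simp_all
    show "(`) (map_prod f f) ` (`) (map_prod g g) ` M = M"
      by (rule map_prod_multicycle_inverse[where g = f and f = g, OF M(1) g(2)])
    show "(`) (map_prod g g) ` M \<in> {M. multicycle V w M \<and> mc_length M = n}"
      unfolding mem_Collect_eq G(3)[OF M(1)] using G(1)[OF M(1)] M(2) by (rule conjI)
    show "(- 1) ^ card ((`) (map_prod g g) ` M) * int (mc_weight w ((`) (map_prod g g) ` M)) =
        (- 1) ^ card M * int (mc_weight w' M)"
      unfolding G(2,4)[OF M(1)] ..
  next
    fix M assume "M \<in> {M. multicycle V w M \<and> mc_length M = n}"
    then have M: "multicycle V w M" "mc_length M = n" by simp_all
    show "(`) (map_prod g g) ` (`) (map_prod f f) ` M = M"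
      by (rule map_prod_multicycle_inverse[where g = g and f = f, OF M(1) f(2)])
    show "(`) (map_prod f f) ` M \<in> {M. multicycle V' w' M \<and> mc_length M = n}"
      unfolding mem_Collect_eq F(3)[OF M(1)] using F(1)[OF M(1)] M(2) by (rule conjI)
  qed
qed

subsection \<open>Counting multicycles in wedge graphs\<close>

lemma card_Domain_single_valued:
  assumes "single_valued R"
  shows "card (Domain R) = card R"
proof -
  have "inj_on fst R" using assms by (auto simp: inj_on_def single_valued_def)
  then show ?thesis unfolding fst_eq_Domain[symmetric] by (rule card_image)
qed

text \<open>A set with at most \<open>s\<close> elements is encoded by a list of length exactly
  \<open>s\<close>, with the extra letter \<open>None\<close> as padding.\<close>

lemma card_subsets_bounded_le:
  assumes "finite U"
  shows "finite {X. X \<subseteq> U \<and> card X \<le> s}" "card {X. X \<subseteq> U \<and> card X \<le> s} \<le> (card U + 1) ^ s"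
proof -
  let ?L = "{xs. set xs \<subseteq> insert None (Some ` U) \<and> length xs = s}"
  have "{X. X \<subseteq> U \<and> card X \<le> s} \<subseteq> (\<lambda>xs. {x. Some x \<in> set xs}) ` ?L"
  proof clarify
    fix X assume X: "X \<subseteq> U" "card X \<le> s"
    obtain ys where ys: "set ys = X" "length ys = card X"
      using finite_distinct_list[of X] finite_subset[OF X(1) assms] distinct_card by metis
    let ?xs = "map Some ys @ replicate (s - card X) None"
    have "X = {x. Some x \<in> set ?xs}" using ys by auto
    moreover have "?xs \<in> ?L" using X ys by auto
    ultimately show "X \<in> (\<lambda>xs. {x. Some x \<in> set xs}) ` ?L" by (rule image_eqI)
  qed
  moreover have fin: "finite ?L" using assms by (intro finite_lists_length_eq) auto
  ultimately have "card {X. X \<subseteq> U \<and> card X \<le> s} \<le> card ?L"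
    by (meson surj_card_le)
  also have "\<dots> = (card U + 1) ^ s"
    using assms by (simp add: card_lists_length_eq card_image)
  finally show "card {X. X \<subseteq> U \<and> card X \<le> s} \<le> (card U + 1) ^ s" .
  show "finite {X. X \<subseteq> U \<and> card X \<le> s}" using assms by simp
qed

text \<open>Let \<open>s\<close> be the rounded-up root of \<open>n\<close>. Each element above
  \<open>q + s\<close> contributes at least \<open>s + 1\<close> to a sum of at most
  \<open>s * s\<close>, so there are at most \<open>s\<close> of them; at most
  \<open>q + s + 1\<close> elements remain.\<close>

lemma card_le_of_sum_le:
  assumes "finite I" "(\<Sum>i\<in>I. i - q) \<le> n"
  shows "card I \<le> q + 1 + 2 * nat \<lceil>sqrt (real n)\<rceil>"
proof -
  define s where "s = nat \<lceil>sqrt (real n)\<rceil>"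
  have "sqrt (real n) \<le> real s" unfolding s_def by linarith
  then have "real n \<le> (real s)\<^sup>2" by (rule sqrt_le_D)
  then have "n \<le> s * s" by (simp add: power2_eq_square flip: of_nat_mult)
  let ?J = "{i\<in>I. q + s < i}"
  have "card ?J * (s + 1) = (\<Sum>i\<in>?J. s + 1)" by simp
  also have "\<dots> \<le> (\<Sum>i\<in>?J. i - q)" by (intro sum_mono) auto
  also have "\<dots> \<le> (\<Sum>i\<in>I. i - q)" using assms(1) by (intro sum_mono2) auto
  also have "\<dots> \<le> s * s" using assms(2) \<open>n \<le> s * s\<close> by simp
  finally have "card ?J * (s + 1) \<le> s * (s + 1)" by (simp add: algebra_simps)
  then have "card ?J \<le> s" by (metis mult_le_cancel2 Suc_eq_plus1 zero_less_Suc)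
  moreover have "card I \<le> card {..q + s} + card ?J"
  proof -
    have "I \<subseteq> {..q + s} \<union> ?J" by auto
    then have "card I \<le> card ({..q + s} \<union> ?J)" using assms(1) by (intro card_mono) auto
    then show ?thesis using card_Un_le[of "{..q + s}" ?J] by linarith
  qed
  ultimately show ?thesis unfolding s_def[symmetric] by simp
qed

text \<open>A common model of \<open>\<Gamma>\<close> and of \<open>\<Gamma>\<^sub>k\<close>, the latter on the ordered representatives \<open>i \<le> j \<le> T = q + k p\<close>
  of the classes; \<open>T = 0\<close> stands for \<open>\<Gamma>\<close>, which has no top level. The successor \<open>fwd\<close> is the upward edge at
  an \<open>N\<close>-vertex and the edge \<open>(1, j + 1)\<close> at an \<open>S\<close>-vertex. Parallel edges occur only at \<open>(q, T)\<close>, where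
  the two targets \<open>(1, q + 1)\<close> and \<open>(1, T + 1)\<close> are identified.\<close>

locale wedge_graph =
  fixes V :: "(nat \<times> nat) set" and w :: "nat \<times> nat \<Rightarrow> nat \<times> nat \<Rightarrow> nat"
    and fwd :: "nat \<times> nat \<Rightarrow> nat \<times> nat" and q T :: nat
  assumes fst_pos: "x \<in> V \<Longrightarrow> 0 < fst x"
    and q_less: "T = 0 \<or> q < T"
    and edge: "x \<in> V \<Longrightarrow> y \<in> V \<Longrightarrow> 0 < w x y \<Longrightarrow> fst x < snd x \<and> (y = fwd x \<or> y = (1, fst x + 1))"
    and fwd_below: "x \<in> V \<Longrightarrow> snd x \<noteq> T \<Longrightarrow> fwd x = (fst x + 1, snd x + 1) \<or> fwd x = (1, snd x + 1)"
    and fwd_top: "x \<in> V \<Longrightarrow> snd x = T \<Longrightarrow> fst x < T \<Longrightarrow>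
      fst (fwd x) \<le> q + 1 \<and> snd (fwd x) \<le> max (fst x + 1) (q + 1)"
    and w_le: "x \<in> V \<Longrightarrow> y \<in> V \<Longrightarrow> w x y \<le> (if x = (q, T) then 2 else 1)"

text \<open>Membership is decided by the target of the arc, so a forward edge that happens to end at
  \<open>(1, i + 1)\<close> counts as backward too.\<close>

definition back_sources :: "((nat \<times> nat) \<times> (nat \<times> nat)) set \<Rightarrow> (nat \<times> nat) set" where
  "back_sources R = {x. (x, (1, fst x + 1)) \<in> R}"

definition top_sources :: "nat \<Rightarrow> ((nat \<times> nat) \<times> (nat \<times> nat)) set \<Rightarrow> (nat \<times> nat) set" where
  "top_sources T R = {x \<in> Domain R. snd x = T}"

text \<open>Abstracts the union of the cycles of a multicycle: a finite permutation of its own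
  vertices along edges of the graph.\<close>

locale wedge_arcs = wedge_graph +
  fixes R :: "((nat \<times> nat) \<times> (nat \<times> nat)) set"
  assumes fin: "finite R" and sv: "single_valued R" and inj: "single_valued (R\<inverse>)"
    and Dom_Ran: "Domain R = Range R" and Dom_V: "Domain R \<subseteq> V"
    and arc_pos: "(x, y) \<in> R \<Longrightarrow> 0 < w x y"
begin

section \<open>Heights and exceptional edges within one multicycle\<close>

lemma fin_Dom: "finite (Domain R)" using fin by (rule finite_Domain)

lemma arc:
  assumes "(x, y) \<in> R"
  shows "x \<in> V" "y \<in> V" "x \<in> Domain R" "y \<in> Domain R" "0 < fst x" "fst x < snd x"
    "y = fwd x \<or> y = (1, fst x + 1)"
proof -
  show 1: "x \<in> Domain R" "y \<in> Domain R" using assms Dom_Ran by auto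
  then show "x \<in> V" "y \<in> V" using Dom_V by auto
  then show "0 < fst x" "fst x < snd x" "y = fwd x \<or> y = (1, fst x + 1)"
    using edge[OF _ _ arc_pos[OF assms]] fst_pos by auto
qed

lemma less_Dom: "x \<in> Domain R \<Longrightarrow> fst x < snd x"
  by (erule DomainE) (rule arc(6))

lemma unmarked_arc:
  assumes "(x, y) \<in> R" "x \<notin> back_sources R \<union> top_sources T R"
  shows "snd y = snd x + 1"
proof -
  have "snd x \<noteq> T" "y \<noteq> (1, fst x + 1)"
    using assms arc(3)[OF assms(1)] by (auto simp: back_sources_def top_sources_def)
  then show ?thesis using arc(1,7)[OF assms(1)] fwd_below[of x] by auto
qed

text \<open>Edges to first coordinate 1 and edges out of the top level end at first coordinate at
  most \<open>q + 1\<close>. Any vertex further right can only be entered along its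
  diagonal.\<close>

lemma pred_diagonal:
  assumes "y \<in> Domain R" "q + 2 \<le> fst y"
  shows "((fst y - 1, snd y - 1), y) \<in> R"
proof -
  obtain x where x: "(x, y) \<in> R" using assms(1) Dom_Ran by auto
  note a = arc[OF x]
  have f: "y = fwd x" using a(7) assms(2) by auto
  have "snd x \<noteq> T" using fwd_top[of x] a(1,6) f assms(2) by auto
  with fwd_below[OF a(1)] f assms(2) have "y = (fst x + 1, snd x + 1)" by auto
  with x show ?thesis by simp
qed

text \<open>Iterates \<open>pred_diagonal\<close>. The arc in the second conjunct shows that each
  earlier vertex of the segment is left along the diagonal, which is what separates segments in
  \<open>card_sources_le\<close>.\<close>

lemma diagonal:
  assumes "y \<in> Domain R" "s + q < fst y"
  shows "(fst y - s, snd y - s) \<in> Domain R \<and>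
    (0 < s \<longrightarrow> ((fst y - s, snd y - s), (fst y - s + 1, snd y - s + 1)) \<in> R)"
  using assms(2)
proof (induction s)
  case 0 then show ?case using assms(1) by simp
next
  case (Suc s)
  let ?z = "(fst y - s, snd y - s)"
  have z: "?z \<in> Domain R" using Suc by simp
  have "((fst ?z - 1, snd ?z - 1), ?z) \<in> R" using Suc.prems by (intro pred_diagonal z) simp
  moreover have "fst y < snd y" using less_Dom assms(1) by blast
  ultimately show ?case using Suc.prems by (auto simp: Suc_diff_Suc)
qed

text \<open>Going back along the diagonal of \<open>y\<close> meets every first coordinate down to
  \<open>q + 1\<close>, and \<open>R\<close> has only \<open>card R\<close> vertices.\<close>

lemma fst_le:
  assumes "y \<in> Domain R"
  shows "fst y \<le> card R + q"
proof -
  have "{q + 1..fst y} \<subseteq> fst ` Domain R"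
  proof
    fix i assume "i \<in> {q + 1..fst y}"
    then show "i \<in> fst ` Domain R"
      using diagonal[OF assms, of "fst y - i"] by (force simp: image_iff)
  qed
  then have "card {q + 1..fst y} \<le> card (Domain R)"
    using surj_card_le[OF fin_Dom] by blast
  then show ?thesis using card_Domain_single_valued[OF sv] by simp
qed

text \<open>An exceptional edge ends at a height controlled by the first coordinate of its source,
  which \<open>fst_le\<close> bounds.\<close>

lemma marked_arc:
  assumes "(x, y) \<in> R" "x \<in> back_sources R \<union> top_sources T R"
  shows "snd y \<le> card R + q + 1"
proof -
  have "fst x \<le> card R + q" using fst_le arc(3)[OF assms(1)] .
  moreover have "y = (1, fst x + 1) \<or> snd x = T"
    using assms(2) single_valuedD[OF sv assms(1), of "(1, fst x + 1)"]
    unfolding back_sources_def top_sources_def by blast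
  moreover have "y = (1, fst x + 1) \<or> snd (fwd x) \<le> max (fst x + 1) (q + 1)" if "snd x = T"
    using that arc(1,6)[OF assms(1)] fwd_top[of x] by auto
  ultimately have "fst x \<le> card R + q" "snd y \<le> max (fst x + 1) (q + 1)"
    using arc(7)[OF assms(1)] by (blast, metis max.cobounded1 snd_conv)
  then show ?thesis by simp
qed

text \<open>Vertices above height \<open>card R + q + 1\<close> are entered only by arcs that raise
  the height by one. Walking back from \<open>x\<close> therefore meets every height down to that
  level, on at most \<open>card R\<close> vertices.\<close>

lemma snd_le:
  assumes "x \<in> Domain R"
  shows "snd x \<le> 2 * card R + q"
proof (cases "snd x \<le> card R + q")
  case False
  have "{card R + q + 1..card R + q + 1 + d} \<subseteq> snd ` Domain R"
    if "z \<in> Domain R" "snd z = card R + q + 1 + d" for d z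
    using that
  proof (induction d arbitrary: z)
    case 0 then show ?case by force
  next
    case (Suc d)
    obtain y where y: "(y, z) \<in> R" using Suc.prems(1) Dom_Ran by auto
    then have "snd z = snd y + 1"
      using marked_arc[OF y] unmarked_arc[OF y] Suc.prems(2) by fastforce
    then have "{card R + q + 1..card R + q + 1 + d} \<subseteq> snd ` Domain R"
      using Suc y by (intro Suc.IH[of y]) auto
    moreover have "card R + q + 1 + Suc d \<in> snd ` Domain R"
      using Suc.prems by (metis image_eqI)
    ultimately show ?case by (auto simp: atLeastAtMostSuc_conv)
  qed
  from this[OF assms, of "snd x - (card R + q + 1)"] False
  have "{card R + q + 1..snd x} \<subseteq> snd ` Domain R" by simp
  then have "card {card R + q + 1..snd x} \<le> card (Domain R)"
    using surj_card_le[OF fin_Dom] by blast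
  then show ?thesis using card_Domain_single_valued[OF sv] False by simp
qed auto

text \<open>Take a vertex of least height among those leading to \<open>v\<close>. Its predecessor
  also leads to \<open>v\<close>, and would be lower if its arc were not exceptional.\<close>

lemma marked_reaches:
  assumes "v \<in> Domain R"
  shows "\<exists>x \<in> Domain R \<inter> (back_sources R \<union> top_sources T R). (x, v) \<in> R\<^sup>*"
proof (rule ccontr)
  assume neg: "\<not> ?thesis"
  let ?Y = "{y \<in> Domain R. (y, v) \<in> R\<^sup>*}"
  have "finite ?Y" using fin_Dom by simp
  moreover have "v \<in> ?Y" using assms by simp
  ultimately have "finite ?Y" "?Y \<noteq> {}" by blast+
  then obtain y where y: "y \<in> ?Y" "\<And>z. z \<in> ?Y \<Longrightarrow> snd y \<le> snd z"
    by (metis (no_types, lifting) arg_min_if_finite(1) arg_min_least)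
  then obtain x where x: "(x, y) \<in> R" using Dom_Ran by auto
  then have xY: "x \<in> ?Y" using y(1) by (auto intro: converse_rtrancl_into_rtrancl)
  then have "snd y = snd x + 1" using neg x by (intro unmarked_arc) auto
  then show False using y(2)[OF xY] by simp
qed

text \<open>Going back from a vertex of \<open>Y\<close> along its diagonal stays inside the multicycle down to
  first coordinate \<open>q + 1\<close>, and by the last hypothesis these diagonal segments are disjoint. As the first
  coordinates are distinct, their lengths sum to at least the order of the square of \<open>card Y\<close>.\<close>

lemma card_sources_le:
  assumes Y: "Y \<subseteq> Domain R" "inj_on fst Y"
    and nd: "\<And>y. y \<in> Y \<Longrightarrow> (y, (fst y + 1, snd y + 1)) \<notin> R"
  shows "card Y \<le> q + 1 + 2 * nat \<lceil>sqrt (real (card R))\<rceil>"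
proof -
  have finY: "finite Y" using Y(1) fin_Dom by (rule finite_subset)
  \<comment> \<open>A pair \<open>(y, s)\<close> stands for the vertex \<open>s\<close> steps back
    on the diagonal of \<open>y\<close>; the range of \<open>s\<close> keeps first coordinates at
    least \<open>q + 1\<close>.\<close>
  let ?D = "SIGMA y:Y. {..<fst y - q}"
  let ?f = "\<lambda>(y, s). (fst y - s, snd y - s)"
  \<comment> \<open>If two segments met with \<open>s < s'\<close>, then \<open>y\<close> would lie
    strictly before \<open>y'\<close> on the same diagonal and be left along it, against
    \<open>nd\<close>.\<close>
  have same: "s' \<le> s" if "y \<in> Y" "y' \<in> Y" "s < fst y - q" "s' < fst y' - q"
    "(fst y - s, snd y - s) = (fst y' - s', snd y' - s')" for y s y' s'
  proof (rule ccontr)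
    assume "\<not> s' \<le> s"
    then have d: "0 < s' - s" "(s' - s) + q < fst y'" using that by auto
    have lt: "fst y < snd y" "fst y' < snd y'" using less_Dom Y(1) that by blast+
    have "y = (fst y' - (s' - s), snd y' - (s' - s))"
      using that lt \<open>\<not> s' \<le> s\<close> by (cases y) auto
    then show False
      using diagonal[of y' "s' - s"] d nd[of y] Y(1) that by auto
  qed
  have "inj_on ?f ?D"
  proof (rule inj_onI, clarify)
    fix a b s a' b' s'
    assume *: "(a, b) \<in> Y" "(a', b') \<in> Y" "s < fst (a, b) - q" "s' < fst (a', b') - q"
      "fst (a, b) - s = fst (a', b') - s'" "snd (a, b) - s = snd (a', b') - s'"
    have "s = s'" using same[of "(a, b)" "(a', b')" s s'] same[of "(a', b')" "(a, b)" s' s] * by auto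
    moreover have "a < b" "a' < b'" using less_Dom Y(1) * by force+
    ultimately show "(a, b) = (a', b') \<and> s = s'" using * by auto
  qed
  moreover have "?f ` ?D \<subseteq> Domain R" using diagonal Y(1) by fastforce
  ultimately have "card ?D \<le> card (Domain R)" using fin_Dom by (rule card_inj_on_le)
  \<comment> \<open>Distinct first coordinates allow indexing the sum by them, the form required by
    \<open>card_le_of_sum_le\<close>.\<close>
  moreover have "card ?D = (\<Sum>i\<in>fst ` Y. i - q)"
    using finY by (simp add: sum.reindex[OF Y(2)])
  ultimately have "card (fst ` Y) \<le> q + 1 + 2 * nat \<lceil>sqrt (real (card R))\<rceil>"
    using finY card_Domain_single_valued[OF sv] by (intro card_le_of_sum_le) auto
  then show ?thesis using card_image[OF Y(2)] by simp
qed

text \<open>Two back sources with the same first coordinate would share their target, against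
  injectivity. The arc is not diagonal because first coordinates are positive.\<close>

lemma card_back_sources_le: "card (back_sources R) \<le> q + 1 + 2 * nat \<lceil>sqrt (real (card R))\<rceil>"
proof (rule card_sources_le)
  show "back_sources R \<subseteq> Domain R" by (auto simp: back_sources_def)
  show "inj_on fst (back_sources R)"
    using inj by (auto simp: back_sources_def inj_on_def single_valued_def)
  fix y assume "y \<in> back_sources R"
  then have y: "(y, (1, fst y + 1)) \<in> R" by (simp add: back_sources_def)
  show "(y, (fst y + 1, snd y + 1)) \<notin> R"
    using single_valuedD[OF sv y, of "(fst y + 1, snd y + 1)"] arc(5)[OF y] by auto
qed

text \<open>Vertices of one level are told apart by the first coordinate. A diagonal arc would end
  at height \<open>T + 1\<close>, but \<open>fwd_top\<close> keeps the target at height at most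
  \<open>T\<close>; for \<open>T = 0\<close> there are no such sources since
  \<open>fst y < snd y\<close>.\<close>

lemma card_top_sources_le: "card (top_sources T R) \<le> q + 1 + 2 * nat \<lceil>sqrt (real (card R))\<rceil>"
proof (rule card_sources_le)
  show "top_sources T R \<subseteq> Domain R" by (auto simp: top_sources_def)
  show "inj_on fst (top_sources T R)" by (auto simp: top_sources_def inj_on_def)
  fix y assume y: "y \<in> top_sources T R"
  show "(y, (fst y + 1, snd y + 1)) \<notin> R"
  proof
    assume a: "(y, (fst y + 1, snd y + 1)) \<in> R"
    have "snd y = T" using y by (simp add: top_sources_def)
    then have "snd (fst y + 1, snd y + 1) \<le> max (fst y + 1) (q + 1)"
      using arc(1,5,6,7)[OF a] fwd_top[of y] by auto
    then show False using arc(6)[OF a] q_less \<open>snd y = T\<close> by auto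
  qed
qed

lemma sources_subset:
  "back_sources R \<subseteq> {..2 * card R + q} \<times> {..2 * card R + q}"
  "top_sources T R \<subseteq> {..2 * card R + q} \<times> {..2 * card R + q}"
proof -
  have "Domain R \<subseteq> {..2 * card R + q} \<times> {..2 * card R + q}"
  proof
    fix x assume "x \<in> Domain R"
    then have "snd x \<le> 2 * card R + q" "fst x < snd x" using snd_le less_Dom by blast+
    then show "x \<in> {..2 * card R + q} \<times> {..2 * card R + q}" by (cases x) auto
  qed
  moreover have "back_sources R \<subseteq> Domain R" "top_sources T R \<subseteq> Domain R"
    by (auto simp: back_sources_def top_sources_def)
  ultimately show "back_sources R \<subseteq> {..2 * card R + q} \<times> {..2 * card R + q}"
    "top_sources T R \<subseteq> {..2 * card R + q} \<times> {..2 * card R + q}"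
    by blast+
qed

text \<open>Only an arc out of \<open>(q, T)\<close> can have multiplicity two, and a single-valued
  \<open>R\<close> contains at most one.\<close>

lemma weight_le: "(\<Prod>(x, y)\<in>R. w x y) \<le> 2"
proof -
  have "(\<Prod>(x, y)\<in>R. w x y) \<le> (\<Prod>p\<in>R. if fst p = (q, T) then 2 else 1)"
  proof (intro prod_mono conjI)
    fix p assume "p \<in> R"
    then show "(case p of (x, y) \<Rightarrow> w x y) \<le> (if fst p = (q, T) then 2 else 1)"
      using w_le[OF arc(1)[of "fst p" "snd p"] arc(2)[of "fst p" "snd p"]]
      by (simp add: case_prod_beta)
  qed simp
  also have "\<dots> = (\<Prod>x\<in>fst ` R. if x = (q, T) then 2 else 1)"
  proof -
    have "inj_on fst R" using sv by (auto simp: inj_on_def single_valued_def)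
    then show ?thesis by (simp add: prod.reindex)
  qed
  also have "\<dots> \<le> 2" using fin by (simp add: prod.delta)
  finally show ?thesis .
qed

end

context wedge_graph
begin

text \<open>The back sources tell which edge is used at every vertex, and every vertex of a multicycle is
  reached from a back source or a top source, since all other edges increase the height.\<close>

lemma sources_determine_subset:
  assumes "wedge_arcs V w fwd q T R1" "wedge_arcs V w fwd q T R2"
    and eq: "back_sources R1 = back_sources R2" "top_sources T R1 = top_sources T R2"
  shows "R1 \<subseteq> R2"
proof -
  interpret R1: wedge_arcs V w fwd q T R1 by fact
  interpret R2: wedge_arcs V w fwd q T R2 by fact
  \<comment> \<open>At a common vertex both arc sets use the backward edge, or neither does and both
    use \<open>fwd a\<close>.\<close>
  have edge_R2: "(a, b) \<in> R2" if R1: "(a, b) \<in> R1" and R2: "a \<in> Domain R2" for a b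
  proof -
    obtain b' where b': "(a, b') \<in> R2" using R2 by (rule DomainE)
    show ?thesis
    proof (cases "a \<in> back_sources R1")
      case True
      then have "(a, (1, fst a + 1)) \<in> R1" "(a, (1, fst a + 1)) \<in> R2"
        using eq by (auto simp: back_sources_def)
      then show ?thesis using R1.sv R1 by (metis single_valuedD)
    next
      case False
      then have "b \<noteq> (1, fst a + 1)" "b' \<noteq> (1, fst a + 1)"
        using R1 b' eq by (auto simp: back_sources_def)
      then show ?thesis using R1.arc(7)[OF R1] R2.arc(7)[OF b'] b' by simp
    qed
  qed
  have "v \<in> Domain R2" if v: "v \<in> Domain R1" for v
  proof -
    obtain x where x: "x \<in> back_sources R1 \<union> top_sources T R1" "(x, v) \<in> R1\<^sup>*"
      using R1.marked_reaches[OF v] by blast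
    have "x \<in> Domain R2" using x(1) unfolding eq by (auto simp: back_sources_def top_sources_def)
    from x(2) this show ?thesis
    proof (induction rule: rtrancl_induct)
      case (step y z)
      show ?case using R2.arc(4)[OF edge_R2[OF step.hyps(2) step.IH[OF step.prems]]] .
    qed
  qed
  then show ?thesis using edge_R2 by (intro subrelI) blast
qed

section \<open>Number of multicycles of given length and bounds on coefficients\<close>

lemma multicycle_wedge_arcs:
  assumes "multicycle V w M"
  shows "wedge_arcs V w fwd q T (\<Union>M)"
proof (intro wedge_arcs.intro wedge_graph_axioms wedge_arcs_axioms.intro)
  fix x y assume "(x, y) \<in> \<Union>M"
  then show "0 < w x y" by (rule multicycle_arcs(6)[OF assms])
qed (rule multicycle_arcs[OF assms])+

lemma multicycle_height_le:
  assumes "multicycle V w M" "x \<in> Domain (\<Union>M)"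
  shows "snd x \<le> 2 * mc_length M + q"
  unfolding multicycle_arcs(7)[OF assms(1)]
  using wedge_arcs.snd_le[OF multicycle_wedge_arcs[OF assms(1)] assms(2)] .

text \<open>A multicycle is encoded by its back sources and its top sources, two subsets of size at
  most \<open>s n\<close> of a square with side \<open>2 * n + q + 1\<close>; hence the factor 2 in
  the exponent.\<close>

lemma multicycles_of_length:
  defines "s \<equiv> \<lambda>n. q + 1 + 2 * nat \<lceil>sqrt (real n)\<rceil>"
  shows "finite {M. multicycle V w M \<and> mc_length M = n}"
    "card {M. multicycle V w M \<and> mc_length M = n} \<le> ((2 * n + q + 1)\<^sup>2 + 1) ^ (2 * s n)"
proof -
  let ?S = "{M. multicycle V w M \<and> mc_length M = n}"
  let ?U = "{..2 * n + q} \<times> {..2 * n + q}"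
  let ?Q = "{X. X \<subseteq> ?U \<and> card X \<le> s n}"
  let ?code = "\<lambda>M. (back_sources (\<Union>M), top_sources T (\<Union>M))"
  have Q: "finite ?Q" "card ?Q \<le> ((2 * n + q + 1)\<^sup>2 + 1) ^ s n"
    using card_subsets_bounded_le[of ?U "s n"] by (simp_all add: power2_eq_square)
  have inj: "inj_on ?code ?S"
  proof (rule inj_onI)
    fix M M' assume M: "M \<in> ?S" "M' \<in> ?S" and eq: "?code M = ?code M'"
    then have "wedge_arcs V w fwd q T (\<Union>M)" "wedge_arcs V w fwd q T (\<Union>M')"
      using multicycle_wedge_arcs by auto
    then have "\<Union>M = \<Union>M'"
      using eq by (intro equalityI sources_determine_subset) auto
    then show "M = M'" using M multicycle_Union_inject[of V w M M'] by blast
  qed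
  have sub: "?code ` ?S \<subseteq> ?Q \<times> ?Q"
  proof (rule image_subsetI)
    fix M assume "M \<in> ?S"
    then have M: "multicycle V w M" "mc_length M = n" by simp_all
    interpret wedge_arcs V w fwd q T "\<Union>M" by (rule multicycle_wedge_arcs[OF M(1)])
    have n: "card (\<Union>M) = n" using M multicycle_arcs(7)[OF M(1)] by simp
    show "?code M \<in> ?Q \<times> ?Q"
      using card_back_sources_le card_top_sources_le sources_subset
      unfolding n s_def by simp
  qed
  show "finite ?S" using inj_on_finite[OF inj sub] Q by simp
  have "card ?S \<le> card (?Q \<times> ?Q)" using card_inj_on_le[OF inj sub] Q by simp
  also have "\<dots> \<le> (((2 * n + q + 1)\<^sup>2 + 1) ^ s n) * (((2 * n + q + 1)\<^sup>2 + 1) ^ s n)"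
    unfolding card_cartesian_product using Q(2) by (intro mult_mono) auto
  finally show "card ?S \<le> ((2 * n + q + 1)\<^sup>2 + 1) ^ (2 * s n)"
    by (simp only: mult_2 power_add)
qed

end

text \<open>The bound on the number of multicycles times the largest weight 2. Its logarithm is of
  order at most sqrt(n) log(n), and it does not involve \<open>T\<close>, so it serves all quotients
  at once.\<close>

definition coeff_bound :: "nat \<Rightarrow> nat \<Rightarrow> nat" where
  "coeff_bound q n = ((2 * n + q + 1)\<^sup>2 + 1) ^ (2 * (q + 1 + 2 * nat \<lceil>sqrt (real n)\<rceil>)) * 2"

lemma (in wedge_graph) abs_spec_coeff_le: "\<bar>spec_coeff V w n\<bar> \<le> int (coeff_bound q n)"
proof -
  let ?S = "{M. multicycle V w M \<and> mc_length M = n}"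
  have "\<bar>spec_coeff V w n\<bar> \<le> (\<Sum>M\<in>?S. \<bar>(-1) ^ card M * int (mc_weight w M)\<bar>)"
    unfolding spec_coeff_def by (rule sum_abs)
  also have "\<dots> \<le> (\<Sum>M\<in>?S. 2)"
  proof (rule sum_mono)
    fix M assume "M \<in> ?S"
    then have M: "multicycle V w M" by simp
    then have "mc_weight w M \<le> 2"
      using wedge_arcs.weight_le[OF multicycle_wedge_arcs] by (simp add: multicycle_arcs(8)[OF M])
    then show "\<bar>(-1) ^ card M * int (mc_weight w M)\<bar> \<le> 2" by (simp add: abs_mult power_abs)
  qed
  also have "\<dots> = int (card ?S * 2)" by simp
  also have "\<dots> \<le> int (coeff_bound q n)"
    unfolding coeff_bound_def of_nat_le_iff using multicycles_of_length(2) by (intro mult_right_mono) auto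
  finally show ?thesis .
qed

text \<open>By \<open>multicycle_height_le\<close>, multicycles of length \<open>n\<close> live at
  heights up to \<open>2 * n + q\<close>, where the two graphs coincide.\<close>

lemma spec_coeff_cong:
  assumes "wedge_graph V w fwd q T" "wedge_graph V' w' fwd' q T'"
    and V: "\<And>x. snd x \<le> 2 * n + q \<Longrightarrow> x \<in> V \<longleftrightarrow> x \<in> V'"
    and w: "\<And>x y. x \<in> V \<Longrightarrow> y \<in> V \<Longrightarrow> snd x \<le> 2 * n + q \<Longrightarrow> snd y \<le> 2 * n + q \<Longrightarrow> w x y = w' x y"
  shows "spec_coeff V w n = spec_coeff V' w' n"
proof -
  let ?U = "{x \<in> V. snd x \<le> 2 * n + q}"
  have U': "?U = {x \<in> V'. snd x \<le> 2 * n + q}" using V by auto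
  have U: "?U \<subseteq> V" "?U \<subseteq> V'" using V by auto
  have w': "w x y = w' x y" if "x \<in> ?U" "y \<in> ?U" for x y using w that by simp
  have 1: "multicycle V' w' M \<and> mc_weight w M = mc_weight w' M"
    if "multicycle V w M" "mc_length M = n" for M
  proof -
    have "Domain (\<Union>M) \<subseteq> ?U"
      using wedge_graph.multicycle_height_le[OF assms(1) that(1)] multicycle_arcs(5)[OF that(1)]
      unfolding that(2) by (intro subsetI CollectI conjI) (erule (1) subsetD | simp)+
    then show ?thesis
      using multicycle_transfer[OF that(1), of ?U V' w', OF _ U(2) w'] by simp
  qed
  have 2: "multicycle V w M" if "multicycle V' w' M" "mc_length M = n" for M
  proof -
    have "Domain (\<Union>M) \<subseteq> ?U"
      unfolding U'
      using wedge_graph.multicycle_height_le[OF assms(2) that(1)] multicycle_arcs(5)[OF that(1)]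
      unfolding that(2) by (intro subsetI CollectI conjI) (erule (1) subsetD | simp)+
    then show ?thesis
      using multicycle_transfer(1)[OF that(1), of ?U V w, OF _ U(1) w'[symmetric]] by simp
  qed
  show ?thesis unfolding spec_coeff_def using 1 2 by (intro sum.cong) auto
qed

text \<open>Cycles have at least one arc, so only the empty multicycle has length 0. This will show
  that the determinant of \<open>\<Gamma>\<close> is not identically zero.\<close>

lemma spec_coeff_0: "spec_coeff V w 0 = 1"
proof -
  have "M = {}" if "multicycle V w M" "mc_length M = 0" for M
  proof -
    have "card (\<Union>M) = 0" using that(2) multicycle_arcs(7)[OF that(1)] by (rule trans[OF sym, rotated])
    then have "\<Union>M = {}" using multicycle_arcs(1)[OF that(1)] by (rule card_0_eq[THEN iffD1, rotated])
    then show ?thesis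
      using that(1) simple_cycle_arcs(2) by (fastforce simp: multicycle_def)
  qed
  moreover have "multicycle V w {}" "mc_length {} = 0"
    by (simp_all add: multicycle_def mc_length_def)
  ultimately have "{M. multicycle V w M \<and> mc_length M = 0} = {{}}" by blast
  then show ?thesis by (simp add: spec_coeff_def mc_weight_def)
qed

subsection \<open>The wedge and its quotients\<close>

text \<open>The shift by \<open>q + 1\<close> makes the representatives above \<open>q\<close> fill
  exactly \<open>q + 1, ..., q + m\<close>, with \<open>q + m + 1\<close> wrapping to
  \<open>q + 1\<close>.\<close>

definition residue_rep :: "nat \<Rightarrow> nat \<Rightarrow> nat \<Rightarrow> nat" where
  "residue_rep m q i = (if i \<le> q then i else q + 1 + (i - q - 1) mod m)"

lemma residue_rep_eq_iff: "residue_rep m q i = residue_rep m q j \<longleftrightarrow> eq_pq m q i j"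
proof (cases "q < i \<and> q < j")
  case True
  have "(i - q - 1) mod m = (j - q - 1) mod m \<longleftrightarrow> i mod m = j mod m"
    using True by (simp add: mod_eq_iff_dvd_symdiff_nat)
  then show ?thesis using True by (auto simp: residue_rep_def eq_pq_def)
qed (auto simp: residue_rep_def eq_pq_def)

lemma residue_rep_id: "i \<le> q + m \<Longrightarrow> residue_rep m q i = i"
  by (auto simp: residue_rep_def)

lemma residue_rep_le: "0 < m \<Longrightarrow> residue_rep m q i \<le> q + m"
  by (auto simp: residue_rep_def Suc_le_eq)

lemma residue_rep_pos: "0 < i \<Longrightarrow> 0 < residue_rep m q i"
  by (auto simp: residue_rep_def)

lemma residue_rep_top: "residue_rep m q (q + m + 1) = q + 1"
  by (auto simp: residue_rep_def)

lemma residue_rep_idem: "0 < m \<Longrightarrow> residue_rep m q (residue_rep m q i) = residue_rep m q i"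
  by (intro residue_rep_id residue_rep_le)

text \<open>The congruence is compatible with adding one, so targets of edges can be computed from
  reduced coordinates.\<close>

lemma residue_rep_add_one:
  assumes "0 < m"
  shows "residue_rep m q (residue_rep m q i + 1) = residue_rep m q (i + 1)"
proof -
  have "eq_pq m q (residue_rep m q i) i"
    using residue_rep_idem[OF assms] by (simp flip: residue_rep_eq_iff)
  then have "eq_pq m q (residue_rep m q i + 1) (i + 1)"
    unfolding eq_pq_def
    using mod_add_cong[of "residue_rep m q i" m i 1 1] by auto
  then show ?thesis by (simp add: residue_rep_eq_iff)
qed

text \<open>The relation on pairs ignores the order of coordinates, and reduction may reverse it;
  sorting restores a vertex of the wedge.\<close>

definition pair_rep :: "nat \<Rightarrow> nat \<Rightarrow> nat \<times> nat \<Rightarrow> nat \<times> nat" where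
  "pair_rep m q v =
    (min (residue_rep m q (fst v)) (residue_rep m q (snd v)),
     max (residue_rep m q (fst v)) (residue_rep m q (snd v)))"

lemma pair_rep_eq_iff: "pair_rep m q v = pair_rep m q u \<longleftrightarrow> eqv_pq m q v u"
  unfolding eqv_pq_def pair_rep_def residue_rep_eq_iff[symmetric]
  by (auto simp: min_def max_def)

definition rep_vertices :: "nat \<Rightarrow> (nat \<times> nat) set" where
  "rep_vertices T = {(i, j). 1 \<le> i \<and> i \<le> j \<and> j \<le> T}"

lemma pair_rep_id: "x \<in> rep_vertices (q + m) \<Longrightarrow> pair_rep m q x = x"
  by (cases x) (auto simp: pair_rep_def rep_vertices_def residue_rep_id)

lemma pair_rep_in: "0 < m \<Longrightarrow> v \<in> wedge_Sigma \<Longrightarrow> pair_rep m q v \<in> rep_vertices (q + m)"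
  using residue_rep_le residue_rep_pos
  by (auto simp: pair_rep_def rep_vertices_def wedge_Sigma_def Suc_le_eq min_def max_def)

lemma rep_vertices_subset: "rep_vertices T \<subseteq> wedge_Sigma"
  by (auto simp: rep_vertices_def wedge_Sigma_def)

lemma out_edges_in_Sigma: "v \<in> wedge_Sigma \<Longrightarrow> u \<in> set (out_edges Phi v) \<Longrightarrow> u \<in> wedge_Sigma"
  by (cases v) (auto simp: wedge_Sigma_def split: label.splits)

text \<open>Targets are filtered from a list, so two edges whose targets become identified count
  twice.\<close>

definition rep_w :: "wedge \<Rightarrow> nat \<Rightarrow> nat \<Rightarrow> nat \<times> nat \<Rightarrow> nat \<times> nat \<Rightarrow> nat" where
  "rep_w Phi m q x y = length (filter (\<lambda>u. pair_rep m q u = y) (out_edges Phi x))"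

text \<open>The classes are the fibres of \<open>pair_rep\<close>; the fibre over \<open>x\<close>
  contains \<open>x\<close> itself, so the choice of a member is legitimate.\<close>

lemma pair_rep_class_bij:
  defines "f \<equiv> \<lambda>m q x. {u \<in> wedge_Sigma. pair_rep m q u = x}"
  assumes m: "0 < m"
  shows "quot_vertices m q = f m q ` rep_vertices (q + m)"
    "x \<in> rep_vertices (q + m) \<Longrightarrow> (SOME v. v \<in> f m q x) \<in> f m q x"
proof -
  have cls: "eqv_rel m q `` {v} = f m q (pair_rep m q v)" if "v \<in> wedge_Sigma" for v
    using that by (auto simp: f_def eqv_rel_def pair_rep_eq_iff[symmetric])
  show "quot_vertices m q = f m q ` rep_vertices (q + m)"
  proof (intro equalityI subsetI)
    fix C assume "C \<in> quot_vertices m q"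
    then obtain v where "v \<in> wedge_Sigma" "C = eqv_rel m q `` {v}"
      unfolding quot_vertices_def by (rule quotientE)
    then show "C \<in> f m q ` rep_vertices (q + m)" using cls pair_rep_in[OF m] by simp
  next
    fix C assume "C \<in> f m q ` rep_vertices (q + m)"
    then obtain x where x: "x \<in> rep_vertices (q + m)" "C = f m q x" by blast
    then have "x \<in> wedge_Sigma" using rep_vertices_subset by blast
    moreover from this have "C = eqv_rel m q `` {x}" using cls x pair_rep_id by simp
    ultimately show "C \<in> quot_vertices m q" unfolding quot_vertices_def by (simp add: quotientI)
  qed
  assume x: "x \<in> rep_vertices (q + m)"
  then have "x \<in> f m q x" using rep_vertices_subset pair_rep_id[OF x] by (auto simp: f_def)
  then show "(SOME v. v \<in> f m q x) \<in> f m q x" by (rule someI)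
qed

text \<open>Edge counts do not depend on the member of the class.\<close>

lemma rep_w_pair_rep:
  assumes m: "0 < m" and Phi: "Phi (pair_rep m q v) = Phi v"
  shows "rep_w Phi m q (pair_rep m q v) y = length (filter (\<lambda>u. pair_rep m q u = y) (out_edges Phi v))"
proof (cases v)
  case (Pair i j)
  let ?r = "residue_rep m q"
  have 1: "pair_rep m q (a, ?r b + 1) = pair_rep m q (a, b + 1)"
    "pair_rep m q (?r a + 1, ?r b + 1) = pair_rep m q (a + 1, b + 1)"
    "pair_rep m q (?r b + 1, ?r a + 1) = pair_rep m q (a + 1, b + 1)" for a b
    using residue_rep_add_one[OF m] by (simp_all add: pair_rep_def min.commute max.commute)
  \<comment> \<open>When sorting swaps the coordinates, the two targets of an
    \<open>S\<close>-vertex trade places and the count is unchanged.\<close>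
  consider "pair_rep m q v = (?r i, ?r j)" | "pair_rep m q v = (?r j, ?r i)"
    by (cases "?r i \<le> ?r j") (simp_all add: Pair pair_rep_def)
  then show ?thesis
  proof cases
    case c: 1
    then show ?thesis using Phi 1 unfolding rep_w_def c by (auto simp: Pair split: label.splits)
  next
    case c: 2
    then show ?thesis using Phi 1 unfolding rep_w_def c by (auto simp: Pair split: label.splits)
  qed
qed

lemma spec_coeff_quotient:
  assumes m: "0 < m"
    and Phi: "\<And>v u. v \<in> wedge_Sigma \<Longrightarrow> u \<in> wedge_Sigma \<Longrightarrow> eqv_pq m q v u \<Longrightarrow> Phi v = Phi u"
  shows "spec_coeff (quot_vertices m q) (quot_w Phi) n = spec_coeff (rep_vertices (q + m)) (rep_w Phi m q) n"
proof (rule spec_coeff_isomorphic)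
  let ?f = "\<lambda>x. {u \<in> wedge_Sigma. pair_rep m q u = x}"
  let ?g = "\<lambda>C. pair_rep m q (SOME v. v \<in> C)"
  note quot = pair_rep_class_bij(1)[OF m, of q] and some = pair_rep_class_bij(2)[OF m, of _ q]
  show gf: "?g (?f x) = x" if "x \<in> rep_vertices (q + m)" for x
    using some[OF that] by blast
  show "?f x \<in> quot_vertices m q" if "x \<in> rep_vertices (q + m)" for x
    using that unfolding quot by (rule imageI)
  fix C assume "C \<in> quot_vertices m q"
  then obtain x where x: "x \<in> rep_vertices (q + m)" "C = ?f x" unfolding quot by (rule imageE)
  show "?g C \<in> rep_vertices (q + m)" "?f (?g C) = C" unfolding x(2) gf[OF x(1)] using x(1) by simp_all
next
  let ?f = "\<lambda>x. {u \<in> wedge_Sigma. pair_rep m q u = x}"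
  fix x y assume x: "x \<in> rep_vertices (q + m)" and y: "y \<in> rep_vertices (q + m)"
  \<comment> \<open>The member chosen by \<open>quot_w\<close>; it need not be the reduced one, so
    its label and edges are compared with those of \<open>x\<close>.\<close>
  define v where "v = (SOME v. v \<in> ?f x)"
  have v: "v \<in> wedge_Sigma" "pair_rep m q v = x"
    using pair_rep_class_bij(2)[OF m x] unfolding v_def[symmetric] by auto
  have "eqv_pq m q x v" using pair_rep_id[OF x] v(2) by (simp flip: pair_rep_eq_iff)
  then have "Phi (pair_rep m q v) = Phi v"
    using Phi[of x v] v x rep_vertices_subset by auto
  from rep_w_pair_rep[OF m this, of y]
  have "rep_w Phi m q x y = length (filter (\<lambda>u. pair_rep m q u = y) (out_edges Phi v))"
    unfolding v(2) .
  also have "filter (\<lambda>u. pair_rep m q u = y) (out_edges Phi v) = filter (\<lambda>u. u \<in> ?f y) (out_edges Phi v)"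
    using out_edges_in_Sigma[OF v(1)] by (intro filter_cong refl) auto
  finally show "quot_w Phi (?f x) (?f y) = rep_w Phi m q x y"
    unfolding quot_w_def v_def by simp
qed

text \<open>No vertex has height 0, so \<open>T = 0\<close> makes the top-level clauses vacuous. An
  \<open>S\<close>-vertex lies off the diagonal, so its two targets differ.\<close>

lemma wedge_graph_Gamma:
  assumes E: "\<forall>i>0. Phi (i, i) = E"
  shows "wedge_graph wedge_Sigma (gamma_w Phi)
    (\<lambda>x. if Phi x = N then (fst x + 1, snd x + 1) else (1, snd x + 1)) q 0"
proof
  fix x y assume "x \<in> wedge_Sigma" "y \<in> wedge_Sigma"
  moreover obtain i j where x: "x = (i, j)" by (cases x)
  ultimately have ij: "0 < i" "i \<le> j" by (auto simp: wedge_Sigma_def)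
  have lt: "i < j" if "Phi (i, j) \<noteq> E" using that E ij by (metis le_neq_implies_less)
  show "fst x < snd x \<and> (y = (if Phi x = N then (fst x + 1, snd x + 1) else (1, snd x + 1)) \<or>
      y = (1, fst x + 1))" if "0 < gamma_w Phi x y"
    using that lt by (auto simp: gamma_w_def x split: label.splits if_splits)
  show "gamma_w Phi x y \<le> (if x = (q, 0) then 2 else 1)"
    using lt ij by (auto simp: gamma_w_def x split: label.splits)
qed (auto simp: wedge_Sigma_def)

lemma wedge_graph_rep:
  assumes m: "0 < m" and E: "\<forall>i>0. Phi (i, i) = E"
  shows "wedge_graph (rep_vertices (q + m)) (rep_w Phi m q)
    (\<lambda>x. pair_rep m q (if Phi x = N then (fst x + 1, snd x + 1) else (1, snd x + 1))) q (q + m)"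
    (is "wedge_graph ?V ?w ?fwd q ?T")
proof
  show "0 < fst x" if "x \<in> ?V" for x using that by (auto simp: rep_vertices_def)
  show "?T = 0 \<or> q < ?T" using m by simp
  fix x assume "x \<in> ?V"
  moreover obtain i j where x: "x = (i, j)" by (cases x)
  ultimately have ij: "0 < i" "i \<le> j" "j \<le> ?T" by (auto simp: rep_vertices_def)
  have lt: "i < j" if "Phi (i, j) \<noteq> E" using that E ij by (metis le_neq_implies_less)
  have one: "pair_rep m q (1, l) = (1, l)" if "0 < l" "l \<le> ?T" for l
    using that by (intro pair_rep_id) (simp add: rep_vertices_def)
  \<comment> \<open>Height \<open>T + 1\<close> wraps to \<open>q + 1\<close>, the only source of
    identified targets.\<close>
  have one_top: "pair_rep m q (1, ?T + 1) = (1, q + 1)"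
    using m residue_rep_top[of m q] residue_rep_id[of 1 q m] by (simp add: pair_rep_def)
  show "?fwd x = (fst x + 1, snd x + 1) \<or> ?fwd x = (1, snd x + 1)" if "snd x \<noteq> ?T"
  proof -
    have "(i + 1, j + 1) \<in> ?V" "(1, j + 1) \<in> ?V" using that ij by (auto simp: x rep_vertices_def)
    then show ?thesis using pair_rep_id by (auto simp: x)
  qed
  show "fst (?fwd x) \<le> q + 1 \<and> snd (?fwd x) \<le> max (fst x + 1) (q + 1)" if "snd x = ?T" "fst x < ?T"
  proof (cases "Phi x = N")
    case True
    have "residue_rep m q (i + 1) = i + 1" using that by (intro residue_rep_id) (simp add: x)
    then show ?thesis
      using True that residue_rep_top[of m q] by (simp add: x pair_rep_def)
  next
    case False
    then show ?thesis using that one_top by (simp add: x)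
  qed
  fix y
  show "fst x < snd x \<and> (y = ?fwd x \<or> y = (1, fst x + 1))" if "0 < ?w x y"
  proof -
    have ne: "Phi (i, j) \<noteq> E" using that by (auto simp: rep_w_def x)
    then have "pair_rep m q (1, i + 1) = (1, i + 1)" using lt ij by (intro one) auto
    then show ?thesis
      using that lt[OF ne] by (auto simp: rep_w_def x split: label.splits if_splits)
  qed
  show "?w x y \<le> (if x = (q, ?T) then 2 else 1)"
  \<comment> \<open>The two targets of an \<open>S\<close>-vertex merge only if \<open>T + 1\<close>
    wraps onto \<open>i + 1\<close>, that is, at \<open>(q, T)\<close>. In the other case the
    out-degree gives the bound.\<close>
  proof (cases "Phi x = S \<and> x \<noteq> (q, ?T)")
    case True
    then have "i < j" using lt by (simp add: x)
    then have 1: "pair_rep m q (1, i + 1) = (1, i + 1)" using ij by (intro one) auto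
    have "pair_rep m q (1, i + 1) \<noteq> pair_rep m q (1, j + 1)"
    proof (cases "j = ?T")
      case True
      then show ?thesis using 1 one_top \<open>Phi x = S \<and> x \<noteq> (q, ?T)\<close> by (auto simp: x)
    next
      case False
      then have "pair_rep m q (1, j + 1) = (1, j + 1)" using ij by (intro one) auto
      then show ?thesis using 1 \<open>i < j\<close> by simp
    qed
    then show ?thesis using True by (auto simp: rep_w_def x)
  next
    case False
    have "?w x y \<le> length (out_edges Phi x)" by (simp add: rep_w_def)
    also have "\<dots> \<le> (if x = (q, ?T) then 2 else 1)"
      using False by (cases "Phi x") (simp_all add: x)
    finally show ?thesis .
  qed
qed

subsection \<open>Convergence of power series and of their zeros\<close>

text \<open>The logarithm of the bound is o(n), so it is beaten by the geometric decay of
  \<open>r ^ n\<close>.\<close>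

lemma summable_coeff_bound:
  assumes "0 \<le> r" "r < 1"
  shows "summable (\<lambda>n. real (coeff_bound q n) * r ^ n)"
proof -
  \<comment> \<open>Raising \<open>r\<close> to at least 1/2 covers \<open>r = 0\<close>, where the
    logarithm would be of no use.\<close>
  define s where "s = max r (1/2)"
  have s: "0 < s" "s < 1" "r \<le> s" using assms by (auto simp: s_def)
  \<comment> \<open>The logarithm of \<open>coeff_bound\<close>, with the ceiling replaced by
    \<open>sqrt n + 1\<close>; this turns \<open>q + 1\<close> into \<open>q + 3\<close>.\<close>
  define g where "g = (\<lambda>n::nat. ln 2 + 2 * (real q + 3 + 2 * sqrt (real n)) * ln ((2 * real n + real q + 1)\<^sup>2 + 1))"
  have bound: "real (coeff_bound q n) \<le> exp (g n)" for n
  proof -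
    define b where "b = (2 * real n + real q + 1)\<^sup>2 + 1"
    have b: "1 \<le> b" by (simp add: b_def)
    let ?e = "2 * (q + 1 + 2 * nat \<lceil>sqrt (real n)\<rceil>)"
    have "real ?e \<le> 2 * (real q + 3 + 2 * sqrt (real n))"
    proof -
      have "real (nat \<lceil>sqrt (real n)\<rceil>) \<le> sqrt (real n) + 1"
        using of_int_ceiling_le_add_one[of "sqrt (real n)"] by simp
      moreover have "real ?e = 2 * (real q + 1 + 2 * real (nat \<lceil>sqrt (real n)\<rceil>))"
        by (simp only: of_nat_mult of_nat_add of_nat_1 of_nat_numeral)
      ultimately show ?thesis by argo
    qed
    then have "real ?e * ln b \<le> 2 * (real q + 3 + 2 * sqrt (real n)) * ln b"
      using b by (intro mult_right_mono) auto
    then have "exp (ln 2 + real ?e * ln b) \<le> exp (g n)" by (simp add: g_def b_def)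
    moreover have "exp (ln 2 + real ?e * ln b) = 2 * b ^ ?e"
      using b by (simp only: exp_add exp_of_nat_mult) simp
    moreover have "real (coeff_bound q n) = 2 * b ^ ?e"
      unfolding coeff_bound_def b_def by (simp add: algebra_simps)
    ultimately show ?thesis by (simp only:)
  qed
  have "(\<lambda>n. g n / real n) \<longlonglongrightarrow> 0" unfolding g_def by real_asymp
  \<comment> \<open>Half of the decay rate of \<open>s ^ n\<close> absorbs \<open>g\<close>; the
    other half leaves a geometric series of ratio \<open>sqrt s\<close>.\<close>
  moreover have "0 < - ln s / 2" using s by simp
  ultimately have "eventually (\<lambda>n. g n / real n < - ln s / 2) sequentially"
    by (rule order_tendstoD(2))
  then have "eventually (\<lambda>n. norm (real (coeff_bound q n) * r ^ n) \<le> exp (ln s / 2) ^ n) sequentially"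
    using eventually_gt_at_top[of 0]
  proof eventually_elim
    case (elim n)
    have "g n \<le> real n * (- ln s / 2)" using elim by (simp add: field_simps)
    then have "g n + real n * ln s \<le> real n * (ln s / 2)" by (simp add: field_simps)
    then have "exp (g n + real n * ln s) \<le> exp (real n * (ln s / 2))" by simp
    moreover have "exp (g n + real n * ln s) = exp (g n) * s ^ n"
      using s by (simp only: exp_add exp_of_nat_mult) simp
    moreover have "real (coeff_bound q n) * r ^ n \<le> exp (g n) * s ^ n"
      using bound assms s by (intro mult_mono power_mono) auto
    ultimately show ?case using assms by (simp only: exp_of_nat_mult) (simp add: abs_mult)
  qed
  moreover have "summable (\<lambda>n. exp (ln s / 2) ^ n)" using s by (intro summable_geometric) simp
  ultimately show ?thesis by (rule summable_comparison_test_ev)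
qed

text \<open>Dominated convergence: finitely many coefficients eventually agree exactly, and the
  common majorant makes both tails small uniformly in \<open>k\<close> and \<open>t\<close>.\<close>

lemma uniform_limit_power_series:
  fixes c :: "nat \<Rightarrow> nat \<Rightarrow> int" and d :: "nat \<Rightarrow> int" and b :: "nat \<Rightarrow> nat"
  assumes c: "\<And>k n. \<bar>c k n\<bar> \<le> int (b n)" and d: "\<And>n. \<bar>d n\<bar> \<le> int (b n)"
    and lim: "\<And>n. eventually (\<lambda>k. c k n = d n) sequentially"
    and sum: "summable (\<lambda>n. real (b n) * r ^ n)" and "0 \<le> r"
  shows "uniform_limit (cball 0 r :: complex set)
    (\<lambda>k t. \<Sum>n. of_int (c k n) * t ^ n) (\<lambda>t. \<Sum>n. of_int (d n) * t ^ n) sequentially"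
proof (rule uniform_limitI)
  fix e :: real assume "0 < e"
  have bd: "norm (of_int a * t ^ n :: complex) \<le> real (b n) * r ^ n"
    if "\<bar>a\<bar> \<le> int (b n)" "t \<in> cball 0 r" for a n and t :: complex
  proof -
    have "\<bar>real_of_int a\<bar> \<le> real (b n)" using that(1) by linarith
    then show ?thesis using that(2) \<open>0 \<le> r\<close>
      by (auto simp: norm_mult norm_power intro!: mult_mono power_mono)
  qed
  have summ: "summable (\<lambda>n. of_int (a n) * t ^ n :: complex)"
    if "\<And>n. \<bar>a n\<bar> \<le> int (b n)" "t \<in> cball 0 r" for a t
    using bd[OF that(1) that(2)] by (intro summable_comparison_test[OF _ sum]) auto
  \<comment> \<open>The cutoff leaves \<open>e / 2\<close> for each of the two tails.\<close>
  obtain m where m: "(\<Sum>n. real (b (n + m)) * r ^ (n + m)) < e / 2"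
  proof -
    obtain m where "norm (\<Sum>n. real (b (n + m)) * r ^ (n + m)) < e / 2"
      using suminf_exist_split[OF half_gt_zero[OF \<open>0 < e\<close>] sum] by blast
    then have "(\<Sum>n. real (b (n + m)) * r ^ (n + m)) < e / 2"
      by (simp only: real_norm_def abs_less_iff)
    then show thesis by (rule that)
  qed
  have tail: "norm (\<Sum>n. of_int (a (n + m)) * t ^ (n + m) :: complex) < e / 2"
    if "\<And>n. \<bar>a n\<bar> \<le> int (b n)" "t \<in> cball 0 r" for a t
  proof -
    have "norm (\<Sum>n. of_int (a (n + m)) * t ^ (n + m) :: complex) \<le> (\<Sum>n. real (b (n + m)) * r ^ (n + m))"
      using bd[OF that(1) that(2)] summable_ignore_initial_segment[OF sum, of m]
      by (intro norm_suminf_le) auto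
    then show ?thesis using m by simp
  qed
  have "eventually (\<lambda>k. \<forall>n<m. c k n = d n) sequentially"
    using eventually_ball_finite[of "{..<m}" "\<lambda>k n. c k n = d n" sequentially] lim
    by (simp add: Ball_def)
  then show "\<forall>\<^sub>F k in sequentially. \<forall>t\<in>cball 0 r.
      dist (\<Sum>n. of_int (c k n) * t ^ n :: complex) (\<Sum>n. of_int (d n) * t ^ n) < e"
  proof eventually_elim
    case (elim k)
    show ?case
    proof
      fix t :: complex assume t: "t \<in> cball 0 r"
      have "(\<Sum>n<m. of_int (c k n) * t ^ n) = (\<Sum>n<m. of_int (d n) * t ^ n)"
        using elim by simp
      then have "dist (\<Sum>n. of_int (c k n) * t ^ n) (\<Sum>n. of_int (d n) * t ^ n) =
          norm ((\<Sum>n. of_int (c k (n + m)) * t ^ (n + m)) - (\<Sum>n. of_int (d (n + m)) * t ^ (n + m)))"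
        unfolding dist_norm suminf_split_initial_segment[OF summ[of "c k", OF c t], of m]
          suminf_split_initial_segment[OF summ[of d, OF d t], of m] by simp
      also have "\<dots> \<le> norm (\<Sum>n. of_int (c k (n + m)) * t ^ (n + m)) +
          norm (\<Sum>n. of_int (d (n + m)) * t ^ (n + m))"
        by (rule norm_triangle_ineq4)
      also have "\<dots> < e" using tail[of "c k", OF c t] tail[of d, OF d t] by linarith
      finally show "dist (\<Sum>n. of_int (c k n) * t ^ n) (\<Sum>n. of_int (d n) * t ^ n) < e" .
    qed
  qed
qed

text \<open>Otherwise infinitely many \<open>F k\<close> have no zero in \<open>U\<close>. Along
  that subsequence Hurwitz's theorem makes the nonconstant limit zero-free, against
  \<open>g z = 0\<close>.\<close>

lemma Hurwitz_zeros_converge: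
  fixes F :: "nat \<Rightarrow> complex \<Rightarrow> complex"
  assumes U: "open U" "connected U" "z \<in> U"
    and hol: "\<And>k. F k holomorphic_on U" "g holomorphic_on U"
    and lim: "\<And>K. compact K \<Longrightarrow> K \<subseteq> U \<Longrightarrow> uniform_limit K F g sequentially"
    and g: "\<not> g constant_on U" "g z = 0"
  shows "eventually (\<lambda>k. \<exists>r\<in>U. F k r = 0) sequentially"
proof (rule ccontr)
  assume "\<not> ?thesis"
  then have "\<exists>\<^sub>F k in sequentially. \<forall>r\<in>U. F k r \<noteq> 0"
    by (simp add: frequently_def)
  then have "infinite {k. \<forall>r\<in>U. F k r \<noteq> 0}"
    by (simp add: frequently_cofinite cofinite_eq_sequentially[symmetric])
  then obtain h :: "nat \<Rightarrow> nat" where h: "strict_mono h" "\<And>k. h k \<in> {k. \<forall>r\<in>U. F k r \<noteq> 0}"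
    using infinite_enumerate by blast
  have "g z \<noteq> 0"
  proof (rule Hurwitz_no_zeros[where S = U and \<F> = "\<lambda>k. F (h k)" and g = g and ?z0.0 = z])
    fix K assume "compact K" "K \<subseteq> U"
    then show "uniform_limit K (\<lambda>k. F (h k)) g sequentially"
      using filterlim_compose[OF lim filterlim_subseq[OF h(1)]] by simp
  qed (use U hol g h(2) in auto)
  then show False using g by simp
qed

section \<open>Uniform convergence of the determinants and approximation of roots\<close>

theorem theorem5p11:
  fixes Phi :: wedge and p q :: nat
  assumes "periodic_wedge Phi p q"
  shows "(\<forall>K. compact K \<and> K \<subseteq> ball 0 1 \<longrightarrow>
            uniform_limit K (\<lambda>k. P_Gamma_k Phi p q (Suc k)) (P_Gamma Phi) sequentially)
       \<and> (\<forall>z. norm z < 1 \<and> P_Gamma Phi z = 0 \<longrightarrow>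
            (\<forall>\<epsilon>>0. \<exists>k0. \<forall>k\<ge>k0. \<exists>r. norm r < 1 \<and> dist r z < \<epsilon> \<and>
                 P_Gamma_k Phi p q (Suc k) r = 0))"
proof -
  have p: "0 < p"
    and inv: "\<And>v u. v \<in> wedge_Sigma \<Longrightarrow> u \<in> wedge_Sigma \<Longrightarrow> eqv_pq p q v u \<Longrightarrow> Phi v = Phi u"
    and diag: "\<forall>i>0. Phi (i, i) = E"
    using assms by (auto simp: periodic_wedge_def wedge_Sigma_def eq_pq_def)
  define c where "c k = spec_coeff (quot_vertices (Suc k * p) q) (quot_w Phi)" for k
  define d where "d = spec_coeff wedge_Sigma (gamma_w Phi)"
  have kp: "0 < Suc k * p" for k using p by simp
  \<comment> \<open>Since \<open>p\<close> divides \<open>Suc k * p\<close>, the finer relation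
    inherits the invariance of the labels.\<close>
  have "eq_pq p q i j" if "eq_pq (Suc k * p) q i j" for i j k
    using that unfolding eq_pq_def by (metis mod_mult_self2_is_0 mod_mod_cancel dvd_triv_right)
  then have eqv: "eqv_pq p q v u" if "eqv_pq (Suc k * p) q v u" for v u k
    using that unfolding eqv_pq_def by blast
  have c: "c k n = spec_coeff (rep_vertices (q + Suc k * p)) (rep_w Phi (Suc k * p) q) n" for k n
    unfolding c_def using spec_coeff_quotient[OF kp] inv eqv by blast
  note G = wedge_graph_Gamma[OF diag, of q] and Gk = wedge_graph_rep[OF kp diag, of q]
  have c_le: "\<bar>c k n\<bar> \<le> int (coeff_bound q n)" for k n
    unfolding c by (rule wedge_graph.abs_spec_coeff_le[OF Gk])
  have d_le: "\<bar>d n\<bar> \<le> int (coeff_bound q n)" for n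
    unfolding d_def by (rule wedge_graph.abs_spec_coeff_le[OF G])
  have c_lim: "eventually (\<lambda>k. c k n = d n) sequentially" for n
    using eventually_ge_at_top[of "2 * n + q"]
  proof eventually_elim
    case (elim k)
    \<comment> \<open>The strict inequality leaves room for edges out of height
      \<open>2 * n + q\<close>, which end at most one level higher and so do not wrap.\<close>
    have "k < Suc k * p" using p by (cases p) simp_all
    with elim have T: "2 * n + q < q + Suc k * p"
      by (intro trans_less_add2) (rule le_less_trans)
    show ?case
      unfolding c d_def
    proof (rule spec_coeff_cong[OF Gk G])
      show "x \<in> rep_vertices (q + Suc k * p) \<longleftrightarrow> x \<in> wedge_Sigma" if "snd x \<le> 2 * n + q" for x
        using that T by (auto simp: rep_vertices_def wedge_Sigma_def)
      fix x y assume x: "x \<in> rep_vertices (q + Suc k * p)" "snd x \<le> 2 * n + q"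
      have "pair_rep (Suc k * p) q u = u" if "u \<in> set (out_edges Phi x)" for u
      proof (rule pair_rep_id)
        show "u \<in> rep_vertices (q + Suc k * p)"
          using that x T by (cases x) (auto simp: rep_vertices_def split: label.splits)
      qed
      then show "rep_w Phi (Suc k * p) q x y = gamma_w Phi x y"
        unfolding rep_w_def gamma_w_def by (intro arg_cong[where f = length] filter_cong refl) simp
    qed
  qed
  have P: "P_Gamma Phi = (\<lambda>t. \<Sum>n. of_int (d n) * t ^ n)"
    "(\<lambda>k. P_Gamma_k Phi p q (Suc k)) = (\<lambda>k t. \<Sum>n. of_int (c k n) * t ^ n)"
    by (simp_all add: spec_det_def c_def d_def fun_eq_iff)
  have lim: "uniform_limit K (\<lambda>k. P_Gamma_k Phi p q (Suc k)) (P_Gamma Phi) sequentially"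
    if K: "compact K" "K \<subseteq> ball 0 1" for K
  proof -
    \<comment> \<open>The radius is the maximal norm on \<open>K\<close>, attained by compactness,
      or 0 for empty \<open>K\<close>.\<close>
    obtain r where r: "0 \<le> r" "r < 1" "K \<subseteq> cball 0 r"
    proof (cases "K = {}")
      case False
      obtain x where x: "x \<in> K" "\<And>y. y \<in> K \<Longrightarrow> norm y \<le> norm x"
        using continuous_attains_sup[OF K(1) False, of norm] continuous_on_norm_id by blast
      then show ?thesis using K(2) by (intro that[of "norm x"]) auto
    qed (use that[of 0] in auto)
    show ?thesis
      unfolding P
      using uniform_limit_power_series[OF c_le d_le c_lim summable_coeff_bound[OF r(1,2)] r(1)] r(3)
      by (rule uniform_limit_on_subset)
  qed
  have hol: "(\<lambda>t. \<Sum>n. of_int (a n) * t ^ n :: complex) holomorphic_on ball 0 1"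
    if "\<And>n. \<bar>a n\<bar> \<le> int (coeff_bound q n)" for a
  proof (rule power_series_holomorphic)
    fix t :: complex assume "t \<in> ball 0 1"
    then have t: "norm t < 1" by simp
    have "norm (of_int (a n) * t ^ n :: complex) \<le> real (coeff_bound q n) * norm t ^ n" for n
    proof -
      have "\<bar>real_of_int (a n)\<bar> \<le> real (coeff_bound q n)" using that[of n] by linarith
      then show ?thesis by (auto simp: norm_mult norm_power intro!: mult_right_mono)
    qed
    then have "summable (\<lambda>n. of_int (a n) * t ^ n :: complex)"
      by (intro summable_comparison_test[OF _ summable_coeff_bound[OF norm_ge_zero t, of q]]) simp
    then show "(\<lambda>n. of_int (a n) * (t - 0) ^ n) sums (\<Sum>n. of_int (a n) * t ^ n)"
      by (simp add: summable_sums)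
  qed
  have near: "\<exists>k0. \<forall>k\<ge>k0. \<exists>r. norm r < 1 \<and> dist r z < e \<and> P_Gamma_k Phi p q (Suc k) r = 0"
    if z: "norm z < 1" "P_Gamma Phi z = 0" and e: "0 < e" for z e
  proof -
    \<comment> \<open>Zeros found here are both close to \<open>z\<close> and inside the disk; as an
      intersection of convex sets the region is connected.\<close>
    let ?U = "ball z e \<inter> ball 0 1"
    have U: "open ?U" "connected ?U" "z \<in> ?U"
      using z e by (auto intro: convex_connected convex_Int)
    \<comment> \<open>A constant value would be 0, since \<open>z\<close> is a root; the identity
      theorem would carry it to the origin, where the determinant is 1.\<close>
    have nc: "\<not> P_Gamma Phi constant_on ?U"
    proof
      assume "P_Gamma Phi constant_on ?U"
      then have 0: "P_Gamma Phi t = 0" if "t \<in> ?U" for t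
        using that U(3) z(2) unfolding constant_on_def by metis
      have "?U \<noteq> {}" using U(3) by blast
      then have "P_Gamma Phi 0 = 0"
        using analytic_continuation_open[of ?U "ball 0 1" "P_Gamma Phi" "\<lambda>_. 0" 0]
          U 0 hol[OF d_le] unfolding P by (auto simp: holomorphic_on_const)
      moreover have "P_Gamma Phi 0 = 1"
        unfolding P by (simp add: powser_zero d_def spec_coeff_0)
      ultimately show False by simp
    qed
    have "eventually (\<lambda>k. \<exists>r\<in>?U. P_Gamma_k Phi p q (Suc k) r = 0) sequentially"
    proof (rule Hurwitz_zeros_converge[OF U _ _ _ nc z(2)])
      show "P_Gamma_k Phi p q (Suc k) holomorphic_on ?U" for k
        using holomorphic_on_subset[OF hol[OF c_le[of k]], of ?U] fun_cong[OF P(2), of k] by simp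
      show "P_Gamma Phi holomorphic_on ?U"
        unfolding P using holomorphic_on_subset[OF hol[OF d_le], of ?U] by simp
      show "uniform_limit K (\<lambda>k. P_Gamma_k Phi p q (Suc k)) (P_Gamma Phi) sequentially"
        if "compact K" "K \<subseteq> ?U" for K using that by (intro lim) auto
    qed
    then show ?thesis
      unfolding eventually_sequentially by (fastforce simp: dist_commute)
  qed
  show ?thesis using lim near by blast
qed

end
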